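(* Let $\delta\in\mathbb{C}$. If a $\delta$-Novikov algebra $N$ over $\mathbb{C}$ has a unity element, then $N$ is commutative and associative.
   Context: A (left) $\delta$-Novikov algebra is a (not necessarily associative) algebra satisfying, for all $x,y,z$, $\delta(xy)z-x(yz)=\delta(yx)z-y(xz)$ and $(xy)z=(xz)y$. *)

theory Defs
  imports Complex_Main
begin

(* Algebras in the sense of nonassociative algebra: a vector space with a bilinear product,
   with neither associativity nor a unit assumed. The underlying set is the whole type 'a,
   which may have any dimension. *)
locale nonassoc_algebra = vector_space scale
  for scale :: "'k::field \<Rightarrow> 'a::ab_group_add \<Rightarrow> 'a" (infixr "*s" 75) +
  fixes mult :: "'a \<Rightarrow> 'a \<Rightarrow> 'a" (infixl "\<odot>" 70)
  assumes mult_linear_right: "Vector_Spaces.linear (*s) (*s) (\<lambda>y. x \<odot> y)"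
    and mult_linear_left: "Vector_Spaces.linear (*s) (*s) (\<lambda>x. x \<odot> y)"

locale delta_novikov_algebra = nonassoc_algebra scale mult
  for \<delta> :: "'k::field"
    and scale :: "'k \<Rightarrow> 'a::ab_group_add \<Rightarrow> 'a" (infixr "*s" 75)
    and mult :: "'a \<Rightarrow> 'a \<Rightarrow> 'a" (infixl "\<odot>" 70) +
  assumes delta_left_symmetric:
      "\<delta> *s ((x \<odot> y) \<odot> z) - x \<odot> (y \<odot> z) = \<delta> *s ((y \<odot> x) \<odot> z) - y \<odot> (x \<odot> z)"
    and right_commutative: "(x \<odot> y) \<odot> z = (x \<odot> z) \<odot> y"

definition is_unity :: "('a \<Rightarrow> 'a \<Rightarrow> 'a) \<Rightarrow> 'a \<Rightarrow> bool" where
  "is_unity mult e \<longleftrightarrow> (\<forall>x. mult e x = x \<and> mult x e = x)"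

end

theory Submission
  imports Defs
begin

text \<open>
  Setting \<open>x = e\<close>, the unity, in right commutativity makes the product commutative. The two
  \<open>\<delta>\<close>-terms of the other identity then cancel, whatever \<open>\<delta>\<close> is, and left commutativity
  \<open>x(yz) = y(xz)\<close> remains; for a commutative product this is associativity.
\<close>

context delta_novikov_algebra
begin

lemma commutative_if_unity:
  assumes "is_unity mult e"
  shows "x \<odot> y = y \<odot> x"
  using right_commutative[of e x y] assms by (simp add: is_unity_def)

lemma associative_if_commutative:
  assumes comm: "\<And>x y. x \<odot> y = y \<odot> x"
  shows "(x \<odot> y) \<odot> z = x \<odot> (y \<odot> z)"
proof -
  have left_commutative: "a \<odot> (b \<odot> c) = b \<odot> (a \<odot> c)" for a b c
    using delta_left_symmetric[of a b c] by (simp add: comm[of b a])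
  have "(x \<odot> y) \<odot> z = z \<odot> (x \<odot> y)"
    by (rule comm)
  also have "\<dots> = x \<odot> (z \<odot> y)"
    by (rule left_commutative)
  also have "\<dots> = x \<odot> (y \<odot> z)"
    by (simp only: comm[of z y])
  finally show ?thesis .
qed

end

theorem proposition8:
  fixes \<delta> :: complex
    and scale :: "complex \<Rightarrow> 'a::ab_group_add \<Rightarrow> 'a"
    and mult :: "'a \<Rightarrow> 'a \<Rightarrow> 'a"
  assumes "delta_novikov_algebra \<delta> scale mult"
    and "\<exists>e. is_unity mult e"
  shows "(\<forall>x y. mult x y = mult y x) \<and>
         (\<forall>x y z. mult (mult x y) z = mult x (mult y z))"
proof -
  interpret delta_novikov_algebra \<delta> scale mult
    by (fact assms(1))
  obtain e where "is_unity mult e"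
    using assms(2) by blast
  then have comm: "mult x y = mult y x" for x y
    by (rule commutative_if_unity)
  then show ?thesis
    using associative_if_commutative by blast
qed

end
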